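(* Neither the pencil of $OD_n$-invariant octics $P_8+\lambda q^4=0$ ($n\geq6$ even) nor the pencil of $ID_n$-invariant surfaces of degree twelve $P_{12}+\lambda q^6=0$ ($n\ge8$ even) in $\mathbb{P}_3(\mathbb{C})$, $\lambda\in\mathbb{P}_1$, contains a surface with isolated singular points.
   Context: Identify $\mathbb{R}^4$ with the quaternions via $(x_0,x_1,x_2,x_3)\leftrightarrow x_0+x_1 i+x_2 j+x_3 k$. A pair $(g_1,g_2)$ of unit quaternions acts on $\mathbb{R}^4$ by $p\mapsto g_1\,p\,g_2^{-1}$; this gives the double covering $SU(2)\times SU(2)\to SO(4)$. Put $\tau=\frac12(1+\sqrt5)$, $\tilde S=\frac12(1+i-j+k)$, $\tilde U=\frac12(\tau+(\tau-1)j+k)$, $\tilde R_n=\cos\frac\pi n+\sin\frac\pi n\,i$; $\tilde D_n=\langle j,\tilde R_n\rangle$, $\tilde O=\langle i,\tilde R_4,\tilde S\rangle$ (binary octahedral), $\tilde I=\langle i,\tilde S,\tilde U\rangle$ (binary icosahedral). $OD_n$, $ID_n$ are the images in $SO(4)$ of $\tilde O\times\tilde D_n$, $\tilde I\times\tilde D_n$. $q=x_0^2+x_1^2+x_2^2+x_3^2$, $X=x_0^2+x_1^2-x_2^2-x_3^2$, $Y=2(x_0x_3+x_1x_2)$, $Z=2(x_1x_3-x_0x_2)$. $P_8=(X+Y-Z)(X-Y+Z)(X+Y+Z)(X-Y-Z)$. $P_{12}=(X-(1-\tau)Z)(X+\tau Y)(X+(1-\tau)Z)(X-\tau Y)((1-\tau)Y-Z)((\tau-1)Y-Z)$.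 *)

theory Defs
  imports "HOL-Analysis.Analysis" "HOL-Algebra.Generated_Groups"
begin

(* Coordinates are numbered from 0 to 3. In the index type 4 the numeral 4 equals 0,
   so 0, 1, 2, 3 are its four distinct elements. The library function "vector" numbers
   its entries from 1 and would put x_0 last. *)

definition vec4 :: "'a \<Rightarrow> 'a \<Rightarrow> 'a \<Rightarrow> 'a \<Rightarrow> 'a ^ 4" where
  "vec4 a b c d = (\<chi> i. if i = 0 then a else if i = 1 then b else if i = 2 then c else d)"

definition quat_mult :: "real ^ 4 \<Rightarrow> real ^ 4 \<Rightarrow> real ^ 4" where
  "quat_mult p r = vec4
     (p $ 0 * r $ 0 - p $ 1 * r $ 1 - p $ 2 * r $ 2 - p $ 3 * r $ 3)
     (p $ 0 * r $ 1 + p $ 1 * r $ 0 + p $ 2 * r $ 3 - p $ 3 * r $ 2)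
     (p $ 0 * r $ 2 - p $ 1 * r $ 3 + p $ 2 * r $ 0 + p $ 3 * r $ 1)
     (p $ 0 * r $ 3 + p $ 1 * r $ 2 - p $ 2 * r $ 1 + p $ 3 * r $ 0)"

definition unit_quat :: "(real ^ 4) monoid" where
  "unit_quat = \<lparr>carrier = {g. norm g = 1}, monoid.mult = quat_mult, one = vec4 1 0 0 0\<rparr>"

definition tau :: real where
  "tau = (1 + sqrt 5) / 2"

definition quat_i :: "real ^ 4" where
  "quat_i = vec4 0 1 0 0"

definition quat_j :: "real ^ 4" where
  "quat_j = vec4 0 0 1 0"

definition quat_S :: "real ^ 4" where
  "quat_S = vec4 (1/2) (1/2) (-1/2) (1/2)"

definition quat_U :: "real ^ 4" where
  "quat_U = vec4 (tau/2) 0 ((tau - 1)/2) (1/2)"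

definition quat_R :: "nat \<Rightarrow> real ^ 4" where
  "quat_R n = vec4 (cos (pi / real n)) (sin (pi / real n)) 0 0"

definition binary_dihedral :: "nat \<Rightarrow> (real ^ 4) set" where
  "binary_dihedral n = generate unit_quat {quat_j, quat_R n}"

definition binary_octahedral :: "(real ^ 4) set" where
  "binary_octahedral = generate unit_quat {quat_i, quat_R 4, quat_S}"

definition binary_icosahedral :: "(real ^ 4) set" where
  "binary_icosahedral = generate unit_quat {quat_i, quat_S, quat_U}"

definition SO4_image :: "real ^ 4 \<Rightarrow> real ^ 4 \<Rightarrow> real ^ 4 ^ 4" where
  "SO4_image g1 g2 = matrix (\<lambda>p. quat_mult (quat_mult g1 p) (inv\<^bsub>unit_quat\<^esub> g2))"

definition OD :: "nat \<Rightarrow> (real ^ 4 ^ 4) set" where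
  "OD n = {SO4_image g1 g2 | g1 g2. g1 \<in> binary_octahedral \<and> g2 \<in> binary_dihedral n}"

definition ID :: "nat \<Rightarrow> (real ^ 4 ^ 4) set" where
  "ID n = {SO4_image g1 g2 | g1 g2. g1 \<in> binary_icosahedral \<and> g2 \<in> binary_dihedral n}"

(* A complex polynomial in x_0, ..., x_3 is represented by its polynomial function, which
   determines it because the field is infinite. *)

definition invariant_under :: "(real ^ 4 ^ 4) set \<Rightarrow> (complex ^ 4 \<Rightarrow> complex) \<Rightarrow> bool" where
  "invariant_under G F \<longleftrightarrow> (\<forall>A\<in>G. \<forall>x. F (map_matrix complex_of_real A *v x) = F x)"

definition form_q :: "complex ^ 4 \<Rightarrow> complex" where
  "form_q x = (x $ 0)^2 + (x $ 1)^2 + (x $ 2)^2 + (x $ 3)^2"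

definition form_X :: "complex ^ 4 \<Rightarrow> complex" where
  "form_X x = (x $ 0)^2 + (x $ 1)^2 - (x $ 2)^2 - (x $ 3)^2"

definition form_Y :: "complex ^ 4 \<Rightarrow> complex" where
  "form_Y x = 2 * (x $ 0 * x $ 3 + x $ 1 * x $ 2)"

definition form_Z :: "complex ^ 4 \<Rightarrow> complex" where
  "form_Z x = 2 * (x $ 1 * x $ 3 - x $ 0 * x $ 2)"

definition P8 :: "complex ^ 4 \<Rightarrow> complex" where
  "P8 x = (let X = form_X x; Y = form_Y x; Z = form_Z x in
     (X + Y - Z) * (X - Y + Z) * (X + Y + Z) * (X - Y - Z))"

definition P12 :: "complex ^ 4 \<Rightarrow> complex" where
  "P12 x = (let X = form_X x; Y = form_Y x; Z = form_Z x; t = complex_of_real tau in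
     (X - (1 - t) * Z) * (X + t * Y) * (X + (1 - t) * Z) * (X - t * Y) *
     ((1 - t) * Y - Z) * ((t - 1) * Y - Z))"

(* Members of the pencils "P + lambda q^m" with lambda ranging over the projective line:
   lambda is the class of (mu : la), the finite values being (1 : la) and infinity (0 : 1). *)

definition pencil8 :: "complex \<Rightarrow> complex \<Rightarrow> complex ^ 4 \<Rightarrow> complex" where
  "pencil8 mu la x = mu * P8 x + la * form_q x ^ 4"

definition pencil12 :: "complex \<Rightarrow> complex \<Rightarrow> complex ^ 4 \<Rightarrow> complex" where
  "pencil12 mu la x = mu * P12 x + la * form_q x ^ 6"

definition proj_eq :: "complex ^ 4 \<Rightarrow> complex ^ 4 \<Rightarrow> bool" where
  "proj_eq x y \<longleftrightarrow> x \<noteq> 0 \<and> y \<noteq> 0 \<and> (\<exists>c. y = c *s x)"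

lemma part_equivp_proj_eq: "part_equivp proj_eq"
proof (rule part_equivpI)
  show "\<exists>x. proj_eq x x"
    unfolding proj_eq_def by (rule exI[of _ "vec 1"], auto simp: vec_eq_iff intro: exI[of _ 1])
  show "symp proj_eq"
  proof (rule sympI)
    fix x y assume *: "proj_eq x y"
    then obtain c where c: "y = c *s x" "y \<noteq> 0" unfolding proj_eq_def by blast
    then have "c \<noteq> 0" by auto
    with c have "x = inverse c *s y" by (simp add: vector_smult_assoc)
    with * show "proj_eq y x" unfolding proj_eq_def by blast
  qed
  show "transp proj_eq"
    unfolding proj_eq_def by (rule transpI) (metis vector_smult_assoc)
qed

quotient_type CP3 = "complex ^ 4" / partial: proj_eq
  by (rule part_equivp_proj_eq)

(* The point with the given homogeneous coordinates; only meaningful for x nonzero. *)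

definition proj_point :: "complex ^ 4 \<Rightarrow> CP3" where
  "proj_point x = abs_CP3 x"

lemma proj_point_eq_iff:
  assumes "x \<noteq> 0" "y \<noteq> 0"
  shows "proj_point x = proj_point y \<longleftrightarrow> (\<exists>c. y = c *s x)"
proof -
  have refl: "proj_eq z z" if "z \<noteq> 0" for z
    using that unfolding proj_eq_def by (auto intro: exI[of _ 1])
  show ?thesis
    unfolding proj_point_def
    using Quotient_rel[OF Quotient_CP3, of x y] refl assms
    by (auto simp: proj_eq_def)
qed

(* The classical quotient topology from the nonzero vectors. An algebraic subset has the same
   isolated points in this topology as in the Zariski topology. *)

instantiation CP3 :: topological_space
begin

definition open_CP3 :: "CP3 set \<Rightarrow> bool" where
  "open_CP3 U \<longleftrightarrow> open {x. x \<noteq> 0 \<and> proj_point x \<in> U}"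

instance
proof
  have "open (- {0 :: complex ^ 4})" by auto
  then show "open (UNIV :: CP3 set)"
    unfolding open_CP3_def by (simp add: Compl_eq)
next
  fix S T :: "CP3 set"
  assume "open S" "open T"
  then have "open ({x. x \<noteq> 0 \<and> proj_point x \<in> S} \<inter> {x. x \<noteq> 0 \<and> proj_point x \<in> T})"
    unfolding open_CP3_def by (rule open_Int)
  moreover have "{x. x \<noteq> 0 \<and> proj_point x \<in> S} \<inter> {x. x \<noteq> 0 \<and> proj_point x \<in> T}
      = {x. x \<noteq> 0 \<and> proj_point x \<in> S \<inter> T}" by auto
  ultimately show "open (S \<inter> T)" unfolding open_CP3_def by simp
next
  fix K :: "CP3 set set"
  assume "\<forall>S\<in>K. open S"
  then have "open (\<Union>S\<in>K. {x. x \<noteq> 0 \<and> proj_point x \<in> S})"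
    unfolding open_CP3_def by (intro open_UN) auto
  moreover have "(\<Union>S\<in>K. {x. x \<noteq> 0 \<and> proj_point x \<in> S}) = {x. x \<noteq> 0 \<and> proj_point x \<in> \<Union>K}"
    by auto
  ultimately show "open (\<Union>K)" unfolding open_CP3_def by simp
qed

end

definition partial_deriv :: "4 \<Rightarrow> (complex ^ 4 \<Rightarrow> complex) \<Rightarrow> complex ^ 4 \<Rightarrow> complex" where
  "partial_deriv i F x = deriv (\<lambda>t. F (x + t *s axis i 1)) 0"

(* Singular points of the surface F = 0 for a form F. The surface is taken with the
   multiplicities of F, so a multiple component is singular everywhere. *)

definition singular_points :: "(complex ^ 4 \<Rightarrow> complex) \<Rightarrow> CP3 set" where
  "singular_points F =
     {proj_point x | x. x \<noteq> 0 \<and> F x = 0 \<and> (\<forall>i. partial_deriv i F x = 0)}"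

end

theory Submission
  imports Defs
begin

text \<open>The triple \<open>(X, Y, Z)\<close> is the vector part of \<open>p i p\<^sup>*\<close>. Hence left multiplication by a unit
  quaternion rotates it, right multiplication by \<open>R\<^sub>n\<close> fixes it and right multiplication by \<open>j\<close>
  negates it. More is true: right multiplication by \<open>1 + t i\<close> scales \<open>X\<close>, \<open>Y\<close>, \<open>Z\<close> and \<open>q\<close> alike by
  \<open>1 + t\<^sup>2\<close>, for every complex \<open>t\<close>. So this one-parameter group acts on the singular locus of each
  member of the pencils, and an isolated singular point would be fixed by it. The fixed points form
  the two lines of eigenvectors of right multiplication by \<open>i\<close>; there \<open>X = Y = Z = q = 0\<close>, so that
  both lines are contained in every singular locus.\<close>

subsection \<open>Coordinates and complexified quaternions\<close>

lemma vec4_nth [simp]: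
  "vec4 a b c d $ 0 = a" "vec4 a b c d $ 1 = b" "vec4 a b c d $ 2 = c" "vec4 a b c d $ 3 = d"
  by (simp_all add: vec4_def)

lemma exhaust_4_from_0: "i = 0 \<or> i = 1 \<or> i = 2 \<or> i = (3::4)"
  using exhaust_4[of i] by auto

lemma forall_4_from_0: "(\<forall>i::4. P i) \<longleftrightarrow> P 0 \<and> P 1 \<and> P 2 \<and> P 3"
proof
  assume P: "P 0 \<and> P 1 \<and> P 2 \<and> P 3"
  show "\<forall>i. P i"
  proof
    fix i show "P i" using exhaust_4_from_0[of i] P by (elim disjE) simp_all
  qed
qed blast

lemma vec4_eq_iff: "x = y \<longleftrightarrow> x $ 0 = y $ 0 \<and> x $ 1 = y $ 1 \<and> x $ 2 = y $ 2 \<and> x $ 3 = y $ 3"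
  for x y :: "'a ^ 4"
  unfolding vec_eq_iff by (rule forall_4_from_0)

lemma sum_4_from_0: "(\<Sum>i\<in>UNIV. f i) = f 0 + f 1 + f 2 + f (3::4)"
  for f :: "4 \<Rightarrow> 'a::comm_monoid_add"
proof -
  \<comment> \<open>The library numbers the four indices from 1 to 4, so its last summand is the one
    at index 0.\<close>
  have "(4::4) = 0" by simp
  then show ?thesis by (simp only: sum_4 ac_simps)
qed

text \<open>The complexified quaternion product: the forms live on \<open>complex ^ 4\<close>, and
  the parameter of the one-parameter group below is complex as well.\<close>

definition cquat_mult :: "complex ^ 4 \<Rightarrow> complex ^ 4 \<Rightarrow> complex ^ 4" where
  "cquat_mult p r = vec4
     (p $ 0 * r $ 0 - p $ 1 * r $ 1 - p $ 2 * r $ 2 - p $ 3 * r $ 3)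
     (p $ 0 * r $ 1 + p $ 1 * r $ 0 + p $ 2 * r $ 3 - p $ 3 * r $ 2)
     (p $ 0 * r $ 2 - p $ 1 * r $ 3 + p $ 2 * r $ 0 + p $ 3 * r $ 1)
     (p $ 0 * r $ 3 + p $ 1 * r $ 2 - p $ 2 * r $ 1 + p $ 3 * r $ 0)"

definition cquat_of :: "real ^ 4 \<Rightarrow> complex ^ 4" where
  "cquat_of g = (\<chi> i. complex_of_real (g $ i))"

lemma cquat_of_nth [simp]: "cquat_of g $ i = complex_of_real (g $ i)"
  by (simp add: cquat_of_def)

lemma cquat_mult_assoc: "cquat_mult (cquat_mult a b) c = cquat_mult a (cquat_mult b c)"
  unfolding vec4_eq_iff cquat_mult_def vec4_nth by (intro conjI; algebra)

lemma quat_mult_assoc: "quat_mult (quat_mult a b) c = quat_mult a (quat_mult b c)"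
  unfolding vec4_eq_iff quat_mult_def vec4_nth by (intro conjI; algebra)

lemma cquat_of_mult: "cquat_of (quat_mult a b) = cquat_mult (cquat_of a) (cquat_of b)"
  unfolding vec4_eq_iff by (simp add: cquat_mult_def quat_mult_def)

lemma cquat_of_one [simp]:
  "cquat_mult (cquat_of (vec4 1 0 0 0)) x = x" "cquat_mult x (cquat_of (vec4 1 0 0 0)) = x"
  unfolding vec4_eq_iff by (simp_all add: cquat_mult_def)

lemma norm_eq_1_quat_iff:
  "norm g = 1 \<longleftrightarrow> (g $ 0)^2 + (g $ 1)^2 + (g $ 2)^2 + (g $ 3)^2 = 1" for g :: "real ^ 4"
  by (simp add: norm_eq_1 inner_vec_def sum_4_from_0 power2_eq_square)

text \<open>Euler's four-square identity makes the norm multiplicative.\<close>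

lemma norm_quat_mult: "norm a = 1 \<Longrightarrow> norm b = 1 \<Longrightarrow> norm (quat_mult a b) = 1"
proof -
  assume "norm a = 1" "norm b = 1"
  moreover have "(quat_mult a b $ 0)^2 + (quat_mult a b $ 1)^2 + (quat_mult a b $ 2)^2
      + (quat_mult a b $ 3)^2
    = ((a $ 0)^2 + (a $ 1)^2 + (a $ 2)^2 + (a $ 3)^2)
      * ((b $ 0)^2 + (b $ 1)^2 + (b $ 2)^2 + (b $ 3)^2)"
    unfolding quat_mult_def vec4_nth by algebra
  ultimately show ?thesis by (simp add: norm_eq_1_quat_iff)
qed

lemma group_unit_quat: "group unit_quat"
proof (rule groupI)
  fix x assume "x \<in> carrier unit_quat"
  then have x: "(x $ 0)^2 + (x $ 1)^2 + (x $ 2)^2 + (x $ 3)^2 = 1"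
    by (simp add: unit_quat_def norm_eq_1_quat_iff)
  \<comment> \<open>The conjugate is the inverse of a unit quaternion.\<close>
  let ?y = "vec4 (x $ 0) (- x $ 1) (- x $ 2) (- x $ 3)"
  have "quat_mult ?y x = vec4 1 0 0 0"
    unfolding vec4_eq_iff using x by (simp add: quat_mult_def power2_eq_square)
  moreover have "norm ?y = 1" using x by (simp add: norm_eq_1_quat_iff)
  ultimately show "\<exists>y\<in>carrier unit_quat. y \<otimes>\<^bsub>unit_quat\<^esub> x = \<one>\<^bsub>unit_quat\<^esub>"
    by (auto simp: unit_quat_def)
next
  fix x assume "x \<in> carrier unit_quat"
  show "\<one>\<^bsub>unit_quat\<^esub> \<otimes>\<^bsub>unit_quat\<^esub> x = x"
    by (simp add: unit_quat_def quat_mult_def vec4_eq_iff)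
next
  show "\<one>\<^bsub>unit_quat\<^esub> \<in> carrier unit_quat"
    by (simp add: unit_quat_def norm_eq_1_quat_iff)
qed (simp_all add: unit_quat_def quat_mult_assoc norm_quat_mult)

section \<open>The image in SO(4) acting on complex coordinates\<close>

lemma cquat_mult_linear:
  "cquat_mult (x + y) z = cquat_mult x z + cquat_mult y z"
  "cquat_mult z (x + y) = cquat_mult z x + cquat_mult z y"
  "cquat_mult (c *s x) z = c *s cquat_mult x z"
  "cquat_mult z (c *s x) = c *s cquat_mult z x"
  unfolding vec4_eq_iff cquat_mult_def vec4_nth vector_add_component vector_smult_component
  by (intro conjI; algebra)+

text \<open>Both sides are complex-linear in \<open>x\<close> and agree on the standard basis, whose
  images are the columns of the real matrix. Invariance thus becomes a question about left and right
  multiplications.\<close>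

lemma SO4_image_complexified:
  "map_matrix complex_of_real (SO4_image g1 g2) *v x
     = cquat_mult (cquat_mult (cquat_of g1) x) (cquat_of (inv\<^bsub>unit_quat\<^esub> g2))"
proof -
  let ?L = "\<lambda>x. cquat_mult (cquat_mult (cquat_of g1) x) (cquat_of (inv\<^bsub>unit_quat\<^esub> g2))"
  have "map_matrix complex_of_real (SO4_image g1 g2) *v x
      = (\<Sum>j\<in>UNIV. x $ j *s ?L (cquat_of (axis j 1)))"
    unfolding vec_eq_iff
    by (simp add: matrix_vector_mult_def map_matrix_def SO4_image_def matrix_def mult.commute
        flip: cquat_of_mult)
  also have "\<dots> = ?L (\<Sum>j\<in>UNIV. x $ j *s cquat_of (axis j 1))"
    unfolding sum_4_from_0 by (simp only: cquat_mult_linear)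
  also have "(\<Sum>j\<in>UNIV. x $ j *s cquat_of (axis j 1)) = x"
    unfolding sum_4_from_0 vec4_eq_iff by (simp add: axis_def)
  finally show ?thesis .
qed

subsection \<open>Invariance\<close>

text \<open>The action is a parameter, so that left and right multiplication share one
  argument.\<close>

definition stabiliser :: "(complex ^ 4 \<Rightarrow> complex) \<Rightarrow> (real ^ 4 \<Rightarrow> complex ^ 4 \<Rightarrow> complex ^ 4) \<Rightarrow>
    (real ^ 4) set" where
  "stabiliser F act = {g \<in> carrier unit_quat. \<forall>x. F (act g x) = F x}"

definition lmult :: "real ^ 4 \<Rightarrow> complex ^ 4 \<Rightarrow> complex ^ 4" where
  "lmult g x = cquat_mult (cquat_of g) x"

definition rmult :: "real ^ 4 \<Rightarrow> complex ^ 4 \<Rightarrow> complex ^ 4" where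
  "rmult g x = cquat_mult x (cquat_of g)"

text \<open>The alternatives in \<open>mult\<close> are a left and a right action. In both,
  \<open>act g\<close> undoes the action of the inverse of \<open>g\<close>, so invariance under
  \<open>g\<close> gives invariance under its inverse.\<close>

lemma subgroup_stabiliser:
  assumes one: "\<And>x. act \<one>\<^bsub>unit_quat\<^esub> x = x"
    and mult: "(\<forall>g h x. act (quat_mult g h) x = act g (act h x)) \<or>
               (\<forall>g h x. act (quat_mult g h) x = act h (act g x))"
  shows "subgroup (stabiliser F act) unit_quat"
proof -
  interpret group unit_quat by (rule group_unit_quat)
  have mult_F: "F (act (g \<otimes>\<^bsub>unit_quat\<^esub> h) x) = F x"
    if "\<forall>x. F (act g x) = F x" "\<forall>x. F (act h x) = F x" for g h x
    using mult that by (auto simp: unit_quat_def)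
  show ?thesis
  proof
    fix g assume g: "g \<in> stabiliser F act"
    then have gc: "g \<in> carrier unit_quat" by (simp add: stabiliser_def)
    have "F (act (inv\<^bsub>unit_quat\<^esub> g) x) = F x" for x
      using mult
    proof
      assume *: "\<forall>g h x. act (quat_mult g h) x = act g (act h x)"
      have "act g (act (inv\<^bsub>unit_quat\<^esub> g) x) = x"
        using r_inv[OF gc] one *[rule_format, of g "inv\<^bsub>unit_quat\<^esub> g"] by (simp add: unit_quat_def)
      with g show ?thesis unfolding stabiliser_def by (metis (mono_tags, lifting) mem_Collect_eq)
    next
      assume *: "\<forall>g h x. act (quat_mult g h) x = act h (act g x)"
      have "act g (act (inv\<^bsub>unit_quat\<^esub> g) x) = x"
        using l_inv[OF gc] one *[rule_format, of "inv\<^bsub>unit_quat\<^esub> g" g] by (simp add: unit_quat_def)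
      with g show ?thesis unfolding stabiliser_def by (metis (mono_tags, lifting) mem_Collect_eq)
    qed
    with gc show "inv\<^bsub>unit_quat\<^esub> g \<in> stabiliser F act" by (simp add: stabiliser_def)
  qed (use one mult_F in \<open>auto simp: stabiliser_def\<close>)
qed

lemma subgroup_stabiliser_mult:
  "subgroup (stabiliser F lmult) unit_quat" "subgroup (stabiliser F rmult) unit_quat"
  by (rule subgroup_stabiliser; simp add: lmult_def rmult_def cquat_of_mult cquat_mult_assoc
      unit_quat_def)+

text \<open>Stabilisers are subgroups, so it suffices to check generators. The inverse of
  \<open>g2\<close>, which acts on the right, lies in the stabiliser together with
  \<open>g2\<close>.\<close>

lemma invariant_underI:
  assumes "A \<subseteq> stabiliser F lmult" "B \<subseteq> stabiliser F rmult"
  shows "invariant_under {SO4_image g1 g2 | g1 g2.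
           g1 \<in> generate unit_quat A \<and> g2 \<in> generate unit_quat B} F"
  unfolding invariant_under_def
proof clarsimp
  fix g1 g2 x
  assume g: "g1 \<in> generate unit_quat A" "g2 \<in> generate unit_quat B"
  interpret group unit_quat by (rule group_unit_quat)
  have "g1 \<in> stabiliser F lmult" "g2 \<in> stabiliser F rmult"
    using g generate_subgroup_incl[OF assms(1) subgroup_stabiliser_mult(1)]
      generate_subgroup_incl[OF assms(2) subgroup_stabiliser_mult(2)] by auto
  then have "\<And>x. F (lmult g1 x) = F x" "\<And>x. F (rmult (inv\<^bsub>unit_quat\<^esub> g2) x) = F x"
    using subgroup.m_inv_closed[OF subgroup_stabiliser_mult(2)] by (auto simp: stabiliser_def)
  then show "F (map_matrix complex_of_real (SO4_image g1 g2) *v x) = F x"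
    unfolding SO4_image_complexified by (simp add: lmult_def rmult_def)
qed

section \<open>Octahedral and icosahedral products of linear forms\<close>

definition oct :: "complex \<Rightarrow> complex \<Rightarrow> complex \<Rightarrow> complex" where
  "oct X Y Z = (X + Y - Z) * (X - Y + Z) * (X + Y + Z) * (X - Y - Z)"

text \<open>The coefficient vectors of the six factors are, up to scalars, the axes through opposite
  vertices of a regular icosahedron, since \<open>t - 1 = 1 / t\<close>.\<close>

definition ico :: "complex \<Rightarrow> complex \<Rightarrow> complex \<Rightarrow> complex" where
  "ico X Y Z = (let t = complex_of_real tau in
     (X - (1 - t) * Z) * (X + t * Y) * (X + (1 - t) * Z) * (X - t * Y) *
     ((1 - t) * Y - Z) * ((t - 1) * Y - Z))"

lemma P8_eq: "P8 x = oct (form_X x) (form_Y x) (form_Z x)"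
  by (simp add: P8_def oct_def Let_def)

lemma P12_eq: "P12 x = ico (form_X x) (form_Y x) (form_Z x)"
  by (simp add: P12_def ico_def Let_def)

lemma tau_square: "tau * tau = tau + 1"
  by (simp add: tau_def field_simps)

lemmas form_defs = form_q_def form_X_def form_Y_def form_Z_def

lemma form_q_cquat_mult: "form_q (cquat_mult a b) = form_q a * form_q b"
  unfolding form_q_def cquat_mult_def vec4_nth by algebra

lemma form_q_unit: "g \<in> carrier unit_quat \<Longrightarrow> form_q (cquat_of g) = 1"
proof -
  assume "g \<in> carrier unit_quat"
  then have "(g $ 0)^2 + (g $ 1)^2 + (g $ 2)^2 + (g $ 3)^2 = 1"
    by (simp add: unit_quat_def norm_eq_1_quat_iff)
  then have "complex_of_real ((g $ 0)^2 + (g $ 1)^2 + (g $ 2)^2 + (g $ 3)^2) = 1"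
    by simp
  then show ?thesis by (simp add: form_q_def)
qed

lemma stabiliser_pencil:
  assumes "g \<in> carrier unit_quat" "act = lmult \<or> act = rmult" "\<And>x. P (act g x) = P x"
  shows "g \<in> stabiliser (\<lambda>x. mu * P x + la * form_q x ^ m) act"
  using assms by (auto simp: stabiliser_def lmult_def rmult_def form_q_cquat_mult form_q_unit)

section \<open>The generators and their action on \<open>X\<close>, \<open>Y\<close>,
  \<open>Z\<close>\<close>

lemma generators_in_carrier:
  "quat_i \<in> carrier unit_quat" "quat_j \<in> carrier unit_quat" "quat_S \<in> carrier unit_quat"
  "quat_U \<in> carrier unit_quat" "quat_R n \<in> carrier unit_quat"
  \<comment> \<open>For \<open>quat_U\<close> the condition amounts to
    \<open>tau^2 + (tau - 1)^2 + 1 = 4\<close>.\<close>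
  using tau_square
  by (simp_all add: unit_quat_def norm_eq_1_quat_iff quat_i_def quat_j_def quat_S_def quat_U_def
      quat_R_def power_divide power2_diff) (simp add: power2_eq_square field_simps)

lemma forms_rotation:
  fixes g x
  defines "a \<equiv> complex_of_real (g $ 0)" and "b \<equiv> complex_of_real (g $ 1)"
    and "c \<equiv> complex_of_real (g $ 2)" and "d \<equiv> complex_of_real (g $ 3)"
  shows
  "form_X (lmult g x) = (a^2 + b^2 - c^2 - d^2) * form_X x + 2 * (b * c - a * d) * form_Y x
      + 2 * (b * d + a * c) * form_Z x"
  "form_Y (lmult g x) = 2 * (b * c + a * d) * form_X x + (a^2 - b^2 + c^2 - d^2) * form_Y x
      + 2 * (c * d - a * b) * form_Z x"
  "form_Z (lmult g x) = 2 * (b * d - a * c) * form_X x + 2 * (c * d + a * b) * form_Y x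
      + (a^2 - b^2 - c^2 + d^2) * form_Z x"
  unfolding lmult_def form_defs cquat_mult_def cquat_of_nth vec4_nth a_def b_def c_def d_def
  by algebra+

lemma forms_lmult_i:
  "form_X (lmult quat_i x) = form_X x" "form_Y (lmult quat_i x) = - form_Y x"
  "form_Z (lmult quat_i x) = - form_Z x"
  unfolding forms_rotation by (simp_all add: quat_i_def)

lemma forms_lmult_R4:
  "form_X (lmult (quat_R 4) x) = form_X x" "form_Y (lmult (quat_R 4) x) = - form_Z x"
  "form_Z (lmult (quat_R 4) x) = form_Y x"
  unfolding forms_rotation
  by (simp_all add: quat_R_def cos_45 sin_45 power2_eq_square flip: of_real_mult)

text \<open>The real part 1/2 is cos(pi/3): a turn by 2 pi/3 about the body diagonal (1, -1, 1) of
  the cube.\<close>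

lemma forms_lmult_S:
  "form_X (lmult quat_S x) = - form_Y x" "form_Y (lmult quat_S x) = - form_Z x"
  "form_Z (lmult quat_S x) = form_X x"
  unfolding forms_rotation by (simp_all add: quat_S_def power2_eq_square)

text \<open>The real part \<open>tau / 2\<close> is cos(pi/5): a turn by 2 pi/5 about (0,
  \<open>tau - 1\<close>, 1), a vertex axis of the icosahedron.\<close>

lemma forms_lmult_U:
  fixes x
  defines "t \<equiv> complex_of_real tau"
  shows
  "form_X (lmult quat_U x) = ((t - 1) * form_X x - t * form_Y x + form_Z x) / 2"
  "form_Y (lmult quat_U x) = (t * form_X x + form_Y x + (t - 1) * form_Z x) / 2"
  "form_Z (lmult quat_U x) = ((t - 1) * form_Y x - form_X x + t * form_Z x) / 2"
proof -
  have t: "t * t = t + 1"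
    unfolding t_def by (metis of_real_1 of_real_add of_real_mult tau_square)
  \<comment> \<open>The same relation with a trailing factor, for rewriting inside right-nested
    products.\<close>
  then have t': "t * (t * z) = t * z + z" for z
    by (metis distrib_right mult.assoc mult_1)
  show "form_X (lmult quat_U x) = ((t - 1) * form_X x - t * form_Y x + form_Z x) / 2"
    "form_Y (lmult quat_U x) = (t * form_X x + form_Y x + (t - 1) * form_Z x) / 2"
    "form_Z (lmult quat_U x) = ((t - 1) * form_Y x - form_X x + t * form_Z x) / 2"
    unfolding forms_rotation
    by (simp_all add: quat_U_def t_def[symmetric] power2_eq_square field_simps t t')
qed

lemma forms_rmult_j:
  "form_X (rmult quat_j x) = - form_X x" "form_Y (rmult quat_j x) = - form_Y x"
  "form_Z (rmult quat_j x) = - form_Z x"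
  by (simp_all add: rmult_def quat_j_def cquat_mult_def form_defs power2_eq_square algebra_simps)

text \<open>The factor \<open>c + s i\<close> commutes with \<open>i\<close>, so
  \<open>p i p\<^sup>*\<close> is multiplied by \<open>(c + s i) (c - s i)\<close>. This serves both
  the rotations \<open>quat_R n\<close> and, with complex \<open>t\<close>, the factors
  \<open>1 + t i\<close>.\<close>

lemma cquat_mult_complex:
  fixes c s x
  defines "y \<equiv> cquat_mult x (vec4 c s 0 0)"
  shows "form_q y = (c^2 + s^2) * form_q x" "form_X y = (c^2 + s^2) * form_X x"
    "form_Y y = (c^2 + s^2) * form_Y x" "form_Z y = (c^2 + s^2) * form_Z x"
  unfolding y_def form_defs cquat_mult_def vec4_nth by algebra+

lemma forms_rmult_R:
  "form_X (rmult (quat_R n) x) = form_X x" "form_Y (rmult (quat_R n) x) = form_Y x"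
  "form_Z (rmult (quat_R n) x) = form_Z x"
proof -
  let ?c = "complex_of_real (cos (pi / real n))" and ?s = "complex_of_real (sin (pi / real n))"
  have "cquat_of (quat_R n) = vec4 ?c ?s 0 0"
    unfolding vec4_eq_iff by (simp add: quat_R_def)
  moreover have "?c^2 + ?s^2 = 1"
    by (simp flip: of_real_power of_real_add)
  ultimately show "form_X (rmult (quat_R n) x) = form_X x"
    "form_Y (rmult (quat_R n) x) = form_Y x" "form_Z (rmult (quat_R n) x) = form_Z x"
    unfolding rmult_def by (simp_all add: cquat_mult_complex)
qed

section \<open>Homogeneity and symmetries of the two products\<close>

lemma oct_scale: "oct (c * X) (c * Y) (c * Z) = c ^ 4 * oct X Y Z"
  unfolding oct_def distrib_left[symmetric] right_diff_distrib[symmetric]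
  by (simp add: power_numeral_reduce)

lemma ico_scale: "ico (c * X) (c * Y) (c * Z) = c ^ 6 * ico X Y Z"
proof -
  define t where "t = complex_of_real tau"
  have *: "c * X - (1 - t) * (c * Z) = c * (X - (1 - t) * Z)" "c * X + t * (c * Y) = c * (X + t * Y)"
    "c * X + (1 - t) * (c * Z) = c * (X + (1 - t) * Z)" "c * X - t * (c * Y) = c * (X - t * Y)"
    "(1 - t) * (c * Y) - c * Z = c * ((1 - t) * Y - Z)"
    "(t - 1) * (c * Y) - c * Z = c * ((t - 1) * Y - Z)"
    by (simp_all add: algebra_simps)
  show ?thesis
    unfolding ico_def Let_def t_def[symmetric] * by (simp add: power_numeral_reduce)
qed

text \<open>The coefficient vectors of the four factors are the body diagonals of the cube up to
  sign. Sign changes and transpositions permute them up to signs that cancel in the product.\<close>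

lemma oct_symmetries:
  "oct (- X) Y Z = oct X Y Z" "oct X (- Y) Z = oct X Y Z" "oct X Y (- Z) = oct X Y Z"
  "oct Y X Z = oct X Y Z" "oct X Z Y = oct X Y Z"
  unfolding oct_def by algebra+

lemma ico_symmetries:
  fixes X Y Z
  defines "t \<equiv> complex_of_real tau"
  shows "ico (- X) Y Z = ico X Y Z" "ico X (- Y) Z = ico X Y Z" "ico X Y (- Z) = ico X Y Z"
    "ico Y Z X = ico X Y Z"
    "ico (((t - 1) * X - t * Y + Z) / 2) ((t * X + Y + (t - 1) * Z) / 2)
       (((t - 1) * Y - X + t * Z) / 2) = ico X Y Z"
proof -
  have t: "t * t = t + 1"
    unfolding t_def by (metis of_real_1 of_real_add of_real_mult tau_square)
  note ico = ico_def Let_def t_def[symmetric]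
  show "ico (- X) Y Z = ico X Y Z" "ico X (- Y) Z = ico X Y Z" "ico X Y (- Z) = ico X Y Z"
    unfolding ico by algebra+
  \<comment> \<open>The shift permutes the six factors up to scalars with product
    \<open>(t * (t - 1))^2 = 1\<close>.\<close>
  show "ico Y Z X = ico X Y Z"
    using t unfolding ico by algebra
  let ?X = "((t - 1) * X - t * Y + Z) / 2" and ?Y = "(t * X + Y + (t - 1) * Z) / 2"
    and ?Z = "((t - 1) * Y - X + t * Z) / 2"
  \<comment> \<open>The rotation fixes the factor \<open>(1 - t) * Y - Z\<close> belonging to its
    axis and permutes the other five cyclically up to scalars, whose product is
    \<open>t * (t - 1) = 1\<close>.\<close>
  have "?X + t * ?Y = t * (X + (t - 1) * Z)" "?X - t * ?Y = - (X + t * Y)"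
    "?X - (1 - t) * ?Z = - ((t - 1) * Y - Z)" "?X + (1 - t) * ?Z = (t - 1) * (X - t * Y)"
    "(1 - t) * ?Y - ?Z = (1 - t) * Y - Z" "(t - 1) * ?Y - ?Z = X + (1 - t) * Z"
    by (simp_all add: field_simps) (use t in algebra)+
  then have "ico ?X ?Y ?Z = (- ((t - 1) * Y - Z)) * (t * (X + (t - 1) * Z)) *
      ((t - 1) * (X - t * Y)) * (- (X + t * Y)) * ((1 - t) * Y - Z) * (X + (1 - t) * Z)"
    unfolding ico by (simp only:)
  also have "\<dots> = (t * (t - 1)) * ico X Y Z"
    unfolding ico by algebra
  also have "t * (t - 1) = 1"
    using t by (simp add: algebra_simps)
  finally show "ico ?X ?Y ?Z = ico X Y Z" by simp
qed

section \<open>Invariance of the two pencils\<close>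

lemma invariant_pencil8: "invariant_under (OD n) (pencil8 mu la)"
  unfolding OD_def binary_octahedral_def binary_dihedral_def pencil8_def[abs_def]
  by (rule invariant_underI; safe intro!: stabiliser_pencil generators_in_carrier)
     (simp_all add: P8_eq oct_symmetries forms_lmult_i forms_lmult_R4 forms_lmult_S
        forms_rmult_j forms_rmult_R)

lemma invariant_pencil12: "invariant_under (ID n) (pencil12 mu la)"
  unfolding ID_def binary_icosahedral_def binary_dihedral_def pencil12_def[abs_def]
  \<comment> \<open>The cyclic shift is kept for the goal of \<open>quat_S\<close>, which acts as
    such a shift up to signs.\<close>
  by (rule invariant_underI; safe intro!: stabiliser_pencil generators_in_carrier)
     (simp_all add: P12_eq ico_symmetries(1-3,5) forms_lmult_i forms_lmult_U forms_lmult_S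
        forms_rmult_j forms_rmult_R, rule ico_symmetries(4))

subsection \<open>Singular points\<close>

text \<open>Holomorphy in several variables, encoded as a Frechet derivative over the reals that
  commutes with complex scalars.\<close>

definition complex_differentiable :: "(complex ^ 4 \<Rightarrow> complex) \<Rightarrow> bool" where
  "complex_differentiable F \<longleftrightarrow>
     (\<forall>x. \<exists>D. (F has_derivative D) (at x) \<and> (\<forall>c h. D (c *s h) = c * D h))"

lemma complex_differentiable_const: "complex_differentiable (\<lambda>x. c)"
  unfolding complex_differentiable_def by (auto intro!: exI[of _ "\<lambda>_. 0"])

lemma complex_differentiable_nth: "complex_differentiable (\<lambda>x. x $ i)"
  unfolding complex_differentiable_def
  by (auto intro!: exI[of _ "\<lambda>h. h $ i"] bounded_linear_imp_has_derivative bounded_linear_vec_nth)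

lemma complex_differentiable_add:
  assumes "complex_differentiable F" "complex_differentiable G"
  shows "complex_differentiable (\<lambda>x. F x + G x)"
  unfolding complex_differentiable_def
proof
  fix x
  obtain D E where "(F has_derivative D) (at x)" "\<forall>c h. D (c *s h) = c * D h"
    "(G has_derivative E) (at x)" "\<forall>c h. E (c *s h) = c * E h"
    using assms unfolding complex_differentiable_def by metis
  then show "\<exists>D. ((\<lambda>x. F x + G x) has_derivative D) (at x) \<and> (\<forall>c h. D (c *s h) = c * D h)"
    by (intro exI[of _ "\<lambda>h. D h + E h"]) (auto intro: has_derivative_add simp: algebra_simps)
qed

lemma complex_differentiable_mult:
  assumes "complex_differentiable F" "complex_differentiable G"
  shows "complex_differentiable (\<lambda>x. F x * G x)"
  unfolding complex_differentiable_def
proof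
  fix x
  obtain D E where "(F has_derivative D) (at x)" "\<forall>c h. D (c *s h) = c * D h"
    "(G has_derivative E) (at x)" "\<forall>c h. E (c *s h) = c * E h"
    using assms unfolding complex_differentiable_def by metis
  then show "\<exists>D. ((\<lambda>x. F x * G x) has_derivative D) (at x) \<and> (\<forall>c h. D (c *s h) = c * D h)"
    by (intro exI[of _ "\<lambda>h. F x * E h + D h * G x"] conjI has_derivative_mult)
       (auto simp: algebra_simps)
qed

lemma complex_differentiable_diff:
  assumes "complex_differentiable F" "complex_differentiable G"
  shows "complex_differentiable (\<lambda>x. F x - G x)"
proof -
  have "complex_differentiable (\<lambda>x. F x + (- 1) * G x)"
    by (intro complex_differentiable_add complex_differentiable_mult complex_differentiable_const
        assms)
  then show ?thesis by simp
qed

lemma complex_differentiable_power: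
  "complex_differentiable F \<Longrightarrow> complex_differentiable (\<lambda>x. F x ^ m)"
  by (induction m) (auto intro: complex_differentiable_const complex_differentiable_mult)

lemmas complex_differentiable_intros =
  complex_differentiable_const complex_differentiable_nth complex_differentiable_add
  complex_differentiable_diff complex_differentiable_mult complex_differentiable_power

lemma complex_differentiable_forms:
  "complex_differentiable form_q" "complex_differentiable form_X"
  "complex_differentiable form_Y" "complex_differentiable form_Z"
  unfolding form_defs[abs_def]
  by (intro complex_differentiable_intros)+

lemma complex_differentiable_P8: "complex_differentiable P8"
  unfolding P8_def[abs_def] Let_def
  by (intro complex_differentiable_intros complex_differentiable_forms)

lemma complex_differentiable_P12: "complex_differentiable P12"
  unfolding P12_def[abs_def] Let_def
  by (intro complex_differentiable_intros complex_differentiable_forms)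

text \<open>The chain rule along \<open>t \<mapsto> x + t *s axis i 1\<close>; homogeneity of
  \<open>D\<close> turns the real derivative into a complex one.\<close>

lemma partial_deriv_eq:
  assumes "(F has_derivative D) (at x)" "\<forall>c h. D (c *s h) = c * D h"
  shows "partial_deriv i F x = D (axis i 1)"
proof -
  have "((\<lambda>t. x + t *s axis i 1) has_derivative (\<lambda>t. t *s axis i 1)) (at 0)"
  proof -
    have "bounded_linear (\<lambda>t::complex. t *s (axis i 1 :: complex ^ 4))"
      by (rule linear_conv_bounded_linear[THEN iffD1], rule linearI)
         (simp_all add: vec_eq_iff algebra_simps)
    then show ?thesis
      by (auto intro!: derivative_eq_intros bounded_linear_imp_has_derivative)
  qed
  moreover have "(F has_derivative D) (at (x + 0 *s axis i 1))" using assms(1) by simp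
  ultimately have "((\<lambda>t. F (x + t *s axis i 1)) has_derivative (\<lambda>t. D (t *s axis i 1))) (at 0)"
    by (rule has_derivative_compose)
  then have "((\<lambda>t. F (x + t *s axis i 1)) has_field_derivative D (axis i 1)) (at 0)"
    using assms(2) by (simp add: has_field_derivative_def mult.commute[of _ "D _"])
  then show ?thesis unfolding partial_deriv_def by (rule DERIV_imp_deriv)
qed

text \<open>The derivative is complex-linear, hence determined by its values on the axes, which are
  the partial derivatives.\<close>

lemma partial_derivs_zero_iff:
  assumes "complex_differentiable F"
  shows "(\<forall>i. partial_deriv i F x = 0) \<longleftrightarrow> (F has_derivative (\<lambda>_. 0)) (at x)"
proof -
  obtain D where D: "(F has_derivative D) (at x)" "\<forall>c h. D (c *s h) = c * D h"
    using assms unfolding complex_differentiable_def by blast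
  have add: "D (g + h) = D g + D h" for g h
    using D(1) by (simp add: has_derivative_linear linear_add)
  have expand: "D h = (\<Sum>i\<in>UNIV. h $ i * D (axis i 1))" for h
  proof -
    have "h = h $ 0 *s axis 0 1 + h $ 1 *s axis 1 1 + h $ 2 *s axis 2 1 + h $ 3 *s axis 3 1"
      unfolding vec4_eq_iff by (simp add: axis_def)
    then have "D h = D (h $ 0 *s axis 0 1 + h $ 1 *s axis 1 1 + h $ 2 *s axis 2 1
        + h $ 3 *s axis 3 1)" by simp
    then show ?thesis by (simp add: add D(2) sum_4_from_0)
  qed
  show ?thesis
  proof
    assume "\<forall>i. partial_deriv i F x = 0"
    then have "D (axis i 1) = 0" for i
      by (simp add: partial_deriv_eq[OF D])
    then have "D = (\<lambda>_. 0)"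
      by (intro ext) (subst expand, simp)
    with D show "(F has_derivative (\<lambda>_. 0)) (at x)" by simp
  qed (simp add: partial_deriv_eq[where D = "\<lambda>_. 0"])
qed

text \<open>Stated with the total derivative, so that the chain and product rules apply
  directly.\<close>

definition singular_vector :: "(complex ^ 4 \<Rightarrow> complex) \<Rightarrow> complex ^ 4 \<Rightarrow> bool" where
  "singular_vector F x \<longleftrightarrow> F x = 0 \<and> (F has_derivative (\<lambda>_. 0)) (at x)"

lemma singular_points_eq:
  assumes "complex_differentiable F"
  shows "singular_points F = {proj_point x | x. x \<noteq> 0 \<and> singular_vector F x}"
  unfolding singular_points_def singular_vector_def partial_derivs_zero_iff[OF assms] by simp

text \<open>By \<open>indep\<close>, the points with \<open>t \<noteq> 0\<close> differ from that of
  \<open>x\<close>; they lie in \<open>S\<close> and tend to it as \<open>t\<close> tends to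
  0.\<close>

lemma not_isolated_if_line:
  assumes "x \<noteq> 0" and indep: "\<And>c t. x + t *s y = c *s x \<Longrightarrow> t = 0"
    and S: "\<And>t. t^2 \<noteq> - 1 \<Longrightarrow> proj_point (x + t *s y) \<in> S"
  shows "\<not> proj_point x isolated_in S"
proof
  assume "proj_point x isolated_in S"
  then obtain U where U: "open U" "U \<inter> S = {proj_point x}"
    unfolding isolated_in_def by blast
  let ?V = "{v. v \<noteq> 0 \<and> proj_point v \<in> U}"
  have V: "open ?V" using U(1) by (simp add: open_CP3_def)
  have x: "x \<in> ?V" using assms(1) U(2) by auto
  \<comment> \<open>Positive real parameters are nonzero and avoid the roots of
    \<open>t^2 = - 1\<close>.\<close>
  have "((\<lambda>t. x + complex_of_real t *s y) \<longlongrightarrow> x) (at_right 0)"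
    by (rule vec_tendstoI) (auto intro!: tendsto_eq_intros)
  from topological_tendstoD[OF this V x]
  have "\<forall>\<^sub>F t in at_right 0. x + complex_of_real t *s y \<in> ?V" .
  moreover have "\<forall>\<^sub>F t in at_right 0. (0::real) < t" by (rule eventually_at_right_less)
  ultimately have "\<forall>\<^sub>F t in at_right 0. (0::real) < t \<and> x + complex_of_real t *s y \<in> ?V"
    by eventually_elim auto
  then obtain t :: real where t: "0 < t" "x + complex_of_real t *s y \<in> ?V"
    using eventually_happens'[OF trivial_limit_at_right_real] by blast
  have "0 < t^2 + 1" by (simp add: add_nonneg_pos)
  then have "complex_of_real (t^2 + 1) \<noteq> 0" by (metis less_irrefl of_real_eq_0_iff)
  then have "(complex_of_real t)^2 \<noteq> - 1" by (simp add: eq_neg_iff_add_eq_0)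
  then have "proj_point (x + complex_of_real t *s y) \<in> U \<inter> S" using t(2) S by simp
  then have "proj_point x = proj_point (x + complex_of_real t *s y)" using U(2) by simp
  with t assms(1) obtain c where "x + complex_of_real t *s y = c *s x"
    by (subst (asm) proj_point_eq_iff) auto
  with indep t(1) show False by fastforce
qed

section \<open>Right multiplication by \<open>1 + t i\<close>\<close>

definition rmult_i :: "complex ^ 4 \<Rightarrow> complex ^ 4" where
  "rmult_i x = cquat_mult x (vec4 0 1 0 0)"

lemma rmult_i_nth [simp]:
  "rmult_i x $ 0 = - x $ 1" "rmult_i x $ 1 = x $ 0" "rmult_i x $ 2 = x $ 3"
  "rmult_i x $ 3 = - x $ 2"
  by (simp_all add: rmult_i_def cquat_mult_def)

lemma one_plus_i_eq: "x + t *s rmult_i x = cquat_mult x (vec4 1 t 0 0)"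
  unfolding vec4_eq_iff by (simp add: cquat_mult_def)

text \<open>For \<open>t^2 \<noteq> - 1\<close> this is a linear automorphism that changes
  \<open>F\<close> by a constant factor. The chain rule is applied to its inverse \<open>?S\<close>,
  right multiplication by \<open>(1 - t i) / (1 + t^2)\<close>.\<close>

lemma singular_vector_one_plus_i:
  assumes hom: "\<And>t x. F (x + t *s rmult_i x) = (1 + t^2) ^ d * F x"
    and x: "singular_vector F x" and t: "t^2 \<noteq> - 1"
  shows "singular_vector F (x + t *s rmult_i x)"
proof -
  let ?y = "x + t *s rmult_i x"
  let ?S = "\<lambda>z. inverse (1 + t^2) *s (z + (- t) *s rmult_i z)"
  let ?k = "(1 + t^2) ^ d"
  have nz: "1 + t^2 \<noteq> 0" using t by (metis add.inverse_unique)
  have S: "?S ?y = x"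
    unfolding vec4_eq_iff using nz
    by (simp add: divide_simps) (simp add: power2_eq_square algebra_simps)
  have S': "?S z + t *s rmult_i (?S z) = z" for z
    unfolding vec4_eq_iff using nz
    by (simp add: divide_simps) (simp add: power2_eq_square algebra_simps)
  have F: "(\<lambda>z. ?k * F (?S z)) = F"
    by (rule ext, subst hom[symmetric], simp only: S')
  have "linear ?S"
    by (rule linearI; unfold vec4_eq_iff; simp add: algebra_simps)
  then have "(?S has_derivative ?S) (at ?y)"
    by (simp add: bounded_linear_imp_has_derivative linear_linear)
  moreover have "(F has_derivative (\<lambda>_. 0)) (at (?S ?y))"
    using x S unfolding singular_vector_def by simp
  ultimately have "((\<lambda>z. F (?S z)) has_derivative (\<lambda>_. 0)) (at ?y)"
    by (rule has_derivative_compose)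
  then have "((\<lambda>z. ?k * F (?S z)) has_derivative (\<lambda>_. ?k * 0)) (at ?y)"
    by (rule has_derivative_mult_right)
  then have "(F has_derivative (\<lambda>_. 0)) (at ?y)"
    unfolding F by simp
  moreover have "F ?y = 0" using hom x unfolding singular_vector_def by simp
  ultimately show ?thesis unfolding singular_vector_def by blast
qed

text \<open>If \<open>p i = k p\<close>, then \<open>q(p) = q(p i) = k^2 q(p) = - q(p)\<close>, so
  \<open>q\<close> vanishes at \<open>p\<close>; hence
  \<open>p i p\<^sup>* = k p p\<^sup>* = k q(p) = 0\<close>.\<close>

lemma eigenvector_forms:
  assumes "rmult_i x = k *s x" "k^2 = - 1"
  shows "form_q x = 0" "form_X x = 0" "form_Y x = 0" "form_Z x = 0"
proof -
  have "- x $ 1 = k * x $ 0" "x $ 3 = k * x $ 2"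
    using assms(1) unfolding vec4_eq_iff by auto
  then have "x $ 1 = - (k * x $ 0)" "x $ 3 = k * x $ 2"
    by (simp_all add: minus_equation_iff[of "x $ 1"])
  then show "form_q x = 0" "form_X x = 0" "form_Y x = 0" "form_Z x = 0"
    using assms(2) unfolding form_defs by algebra+
qed

text \<open>If \<open>x\<close> is no eigenvector of \<open>rmult_i\<close>, its orbit gives the
  line of singular points. Otherwise the whole eigenspace is singular by \<open>base\<close>, and it
  contains a line through the point.\<close>

lemma no_isolated_singular_point:
  assumes F: "complex_differentiable F"
    and hom: "\<And>t x. F (x + t *s rmult_i x) = (1 + t^2) ^ d * F x"
    and base: "\<And>x. form_q x = 0 \<Longrightarrow> form_X x = 0 \<Longrightarrow> form_Y x = 0 \<Longrightarrow> form_Z x = 0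
                \<Longrightarrow> singular_vector F x"
  shows "\<not> p isolated_in singular_points F"
proof
  assume iso: "p isolated_in singular_points F"
  then have "p \<in> singular_points F" by (simp add: isolated_in_def)
  then obtain x where x: "x \<noteq> 0" "singular_vector F x" "p = proj_point x"
    unfolding singular_points_eq[OF F] by blast
  have "\<exists>y. (\<forall>c t. x + t *s y = c *s x \<longrightarrow> t = 0) \<and>
            (\<forall>t. t^2 \<noteq> - 1 \<longrightarrow> singular_vector F (x + t *s y))"
  proof (cases "\<exists>k. rmult_i x = k *s x")
    case True
    then obtain k where k: "rmult_i x = k *s x" by blast
    \<comment> \<open>Since \<open>i^2 = - 1\<close>, the eigenvalue satisfies
      \<open>k^2 = - 1\<close>.\<close>
    have "- x = rmult_i (rmult_i x)" unfolding vec4_eq_iff by simp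
    also have "\<dots> = rmult_i (k *s x)" by (simp only: k)
    also have "\<dots> = k *s rmult_i x" unfolding vec4_eq_iff by simp
    also have "\<dots> = k^2 *s x" by (simp add: k power2_eq_square)
    finally have kx: "- x = k^2 *s x" .
    obtain i where i: "x $ i \<noteq> 0" using x(1) unfolding vec_eq_iff by auto
    have "(- x) $ i = (k^2 *s x) $ i" by (simp only: kx)
    then have "(k^2 + 1) * x $ i = 0" by (simp add: distrib_right) (metis add.left_inverse)
    then have k2: "k^2 = - 1" using i by (simp add: eq_neg_iff_add_eq_0)
    \<comment> \<open>The two vectors form a basis of the eigenspace of \<open>k\<close>; the choice
      makes \<open>y\<close> independent of \<open>x\<close>, as coordinates 0 and 2 show.\<close>
    define y where "y = (if x $ 0 = 0 then vec4 1 (- k) 0 0 else vec4 0 0 1 k)"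
    have "rmult_i y = k *s y"
      unfolding vec4_eq_iff y_def using k2 by (simp add: power2_eq_square)
    moreover have "rmult_i (x + t *s y) = rmult_i x + t *s rmult_i y" for t
      unfolding vec4_eq_iff by simp
    ultimately have "rmult_i (x + t *s y) = k *s (x + t *s y)" for t
      by (simp only: k) (simp only: vector_add_ldistrib vector_smult_assoc mult.commute)
    then have "singular_vector F (x + t *s y)" for t
      by (intro base eigenvector_forms[OF _ k2])
    moreover have "t = 0" if "x + t *s y = c *s x" for c t
    proof -
      have "(x + t *s y) $ 0 = (c *s x) $ 0" "(x + t *s y) $ 2 = (c *s x) $ 2"
        by (simp_all only: that)
      then show ?thesis unfolding y_def by (cases "x $ 0 = 0") simp_all
    qed
    ultimately show ?thesis by blast
  next
    case False
    have "t = 0" if "x + t *s rmult_i x = c *s x" for c t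
    proof (rule ccontr)
      assume t: "t \<noteq> 0"
      have "rmult_i x $ i = ((c - 1) / t) * x $ i" for i
      proof -
        have "(x + t *s rmult_i x) $ i = (c *s x) $ i" by (simp only: that)
        then show ?thesis using t by (simp add: field_simps)
      qed
      then have "rmult_i x = ((c - 1) / t) *s x" unfolding vec_eq_iff by simp
      with False show False by blast
    qed
    then show ?thesis using singular_vector_one_plus_i[OF hom x(2)] by blast
  qed
  then obtain y where y: "\<And>c t. x + t *s y = c *s x \<Longrightarrow> t = 0"
    "\<And>t. t^2 \<noteq> - 1 \<Longrightarrow> singular_vector F (x + t *s y)" by blast
  have "proj_point (x + t *s y) \<in> singular_points F" if "t^2 \<noteq> - 1" for t
  proof -
    have "x + t *s y \<noteq> 0"
      using y(1)[of t 0] x(1) by auto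
    then show ?thesis using y(2)[OF that] unfolding singular_points_eq[OF F] by blast
  qed
  then have "\<not> proj_point x isolated_in singular_points F"
    by (rule not_isolated_if_line[OF x(1), of y, rotated]) (assumption, rule y(1))
  with iso x(3) show False by simp
qed

text \<open>Each term of the product rule keeps a vanishing factor.\<close>

lemma singular_vector_mult:
  assumes "complex_differentiable F" "complex_differentiable G" "F x = 0" "G x = 0"
  shows "singular_vector (\<lambda>x. F x * G x) x"
proof -
  obtain D E where "(F has_derivative D) (at x)" "(G has_derivative E) (at x)"
    using assms(1,2) unfolding complex_differentiable_def by metis
  from has_derivative_mult[OF this] show ?thesis
    using assms(3,4) by (simp add: singular_vector_def)
qed

lemma singular_vector_pencil:
  assumes "singular_vector P x" "form_q x = 0" "m \<ge> 2"
  shows "singular_vector (\<lambda>x. mu * P x + la * form_q x ^ m) x"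
proof -
  \<comment> \<open>With exponent at least 2, one \<open>form_q\<close> splits off and the remaining
    power still vanishes at \<open>x\<close>.\<close>
  obtain k where m: "m = Suc (Suc k)" using le_Suc_ex[OF assms(3)] by auto
  have "singular_vector (\<lambda>x. form_q x * form_q x ^ Suc k) x"
    by (intro singular_vector_mult complex_differentiable_intros complex_differentiable_forms)
       (simp_all add: assms(2))
  then have "((\<lambda>x. form_q x ^ m) has_derivative (\<lambda>_. 0)) (at x)"
    unfolding m by (simp add: singular_vector_def)
  from has_derivative_add[OF has_derivative_mult_right[of P "\<lambda>_. 0" _ mu]
      has_derivative_mult_right[OF this, of la]] assms
  show ?thesis by (simp add: singular_vector_def)
qed

section \<open>Application to the two pencils\<close>

lemma pencil8_no_isolated_singular_point: "\<not> p isolated_in singular_points (pencil8 mu la)"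
proof (rule no_isolated_singular_point)
  show "complex_differentiable (pencil8 mu la)"
    unfolding pencil8_def[abs_def]
    by (intro complex_differentiable_intros complex_differentiable_forms complex_differentiable_P8)
  \<comment> \<open>\<open>P8\<close> and \<open>form_q ^ 4\<close> both have degree 4 in the
    quadratic forms, each scaled by \<open>1 + t^2\<close>.\<close>
  show "pencil8 mu la (x + t *s rmult_i x) = (1 + t^2) ^ 4 * pencil8 mu la x" for t x
    unfolding pencil8_def P8_eq one_plus_i_eq cquat_mult_complex
    by (simp add: oct_scale power_mult_distrib distrib_left)
  fix x assume "form_q x = 0" "form_X x = 0" "form_Y x = 0" "form_Z x = 0"
  \<comment> \<open>All linear factors of \<open>P8\<close> vanish at \<open>x\<close>, so the
    product rule applies with the last one split off.\<close>
  then show "singular_vector (pencil8 mu la) x"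
    unfolding pencil8_def[abs_def] P8_def[abs_def] Let_def
    by (intro singular_vector_pencil singular_vector_mult complex_differentiable_intros
        complex_differentiable_forms) simp_all
qed

lemma pencil12_no_isolated_singular_point: "\<not> p isolated_in singular_points (pencil12 mu la)"
proof (rule no_isolated_singular_point)
  show "complex_differentiable (pencil12 mu la)"
    unfolding pencil12_def[abs_def]
    by (intro complex_differentiable_intros complex_differentiable_forms complex_differentiable_P12)
  show "pencil12 mu la (x + t *s rmult_i x) = (1 + t^2) ^ 6 * pencil12 mu la x" for t x
    unfolding pencil12_def P12_eq one_plus_i_eq cquat_mult_complex
    by (simp add: ico_scale power_mult_distrib distrib_left)
  fix x assume "form_q x = 0" "form_X x = 0" "form_Y x = 0" "form_Z x = 0"
  then show "singular_vector (pencil12 mu la) x"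
    unfolding pencil12_def[abs_def] P12_def[abs_def] Let_def
    by (intro singular_vector_pencil singular_vector_mult complex_differentiable_intros
        complex_differentiable_forms) simp_all
qed

theorem lemma5p7:
  shows "(\<forall>n::nat. n \<ge> 6 \<and> even n \<longrightarrow>
            (\<forall>mu la::complex. (mu, la) \<noteq> (0, 0) \<longrightarrow>
               invariant_under (OD n) (pencil8 mu la) \<and>
               \<not> (\<exists>p. p isolated_in singular_points (pencil8 mu la)))) \<and>
         (\<forall>n::nat. n \<ge> 8 \<and> even n \<longrightarrow>
            (\<forall>mu la::complex. (mu, la) \<noteq> (0, 0) \<longrightarrow>
               invariant_under (ID n) (pencil12 mu la) \<and>
               \<not> (\<exists>p. p isolated_in singular_points (pencil12 mu la))))"
  using invariant_pencil8 invariant_pencil12 pencil8_no_isolated_singular_point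
    pencil12_no_isolated_singular_point by blast

end
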